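(* For integers $n\ge1$ and $0\le k\le n-1$, the number $f_n^{(k)}$ of nodes at height $k$ in $T_n$ is given by $$f_n^{(k)}=\varphi_n^{(k+2)}-\varphi_n^{(k+1)}=(k+1)^{n-k-1}(k+1)!-k^{n-k}k!=k!\cdot\left((k+1)^{n-k}-k^{n-k}\right).$$
   Context: $S_n$ is the set of permutations $\sigma=\sigma_1\dots\sigma_n$ of $\{1,\dots,n\}$ and $id_n=12\dots n$. The bubblesort operator $\mathbf{B}$ is one pass of the bubblesort algorithm: scan the positions from left to right, each time exchanging the current element with the one to its right whenever the latter is smaller. Equivalently, writing $\sigma=\mu_1A_1\mu_2A_2\dots\mu_rA_r$ where the $\mu_i$ are all the left-to-right maxima of $\sigma$ (elements larger than all elements to their left) and the $A_i$ are possibly empty sequences, $\mathbf{B}(\sigma)=A_1\mu_1A_2\mu_2\dots A_r\mu_r$. $T_n$ is the rooted tree whose nodes are the permutations in $S_n$, with root $id_n$, in which $\tau$ is a child of $\sigma$ if and only if $\mathbf{B}(\tau)=\sigma$ and $\sigma\ne\tau$. The height of a node is the number of edges on the path connecting it to the root. $\Gamma_k$ is the set of all permutations of size $k$ whose final element is $1$; $\mathrm{Av}_n(\Gamma_k)$ is the set of permutations of size $n$ avoiding (in the sense of classical pattern avoidance: having no subsequence order-isomorphic to) every element of $\Gamma_k$; and $\varphi_n^{(k)}=|\mathrm{Av}_n(\Gamma_k)|$. *)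

theory Defs
  imports
    "HOL-Combinatorics.Multiset_Permutations"
    "HOL-Library.Sublist"
    "Graph_Theory.Graph_Theory"
begin

text \<open>Permutations are represented in one-line notation, as lists of natural numbers.\<close>

definition perms :: "nat \<Rightarrow> nat list set" where
  "perms n = permutations_of_set {1..n}"

definition id_perm :: "nat \<Rightarrow> nat list" where
  "id_perm n = [1..<Suc n]"

fun bubblesort_pass :: "nat list \<Rightarrow> nat list" where
  "bubblesort_pass [] = []"
| "bubblesort_pass [x] = [x]"
| "bubblesort_pass (x # y # xs) =
     (if y < x then y # bubblesort_pass (x # xs) else x # bubblesort_pass (y # xs))"

text \<open>The tree is oriented away from its root: an arc is a pair (parent, child).\<close>

definition bubblesort_tree :: "nat \<Rightarrow> (nat list, nat list \<times> nat list) pre_digraph" where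
  "bubblesort_tree n =
     \<lparr> verts = perms n,
       arcs = {(\<sigma>, \<tau>). \<sigma> \<in> perms n \<and> \<tau> \<in> perms n \<and> bubblesort_pass \<tau> = \<sigma> \<and> \<sigma> \<noteq> \<tau>},
       tail = fst,
       head = snd \<rparr>"

text \<open>A path is a list of arcs, so its length is its number of edges.\<close>

definition height :: "nat \<Rightarrow> nat list \<Rightarrow> nat" where
  "height n \<tau> = length (THE p. pre_digraph.apath (bubblesort_tree n) (id_perm n) p \<tau>)"

definition num_at_height :: "nat \<Rightarrow> nat \<Rightarrow> nat" where
  "num_at_height n k = card {\<tau> \<in> verts (bubblesort_tree n). height n \<tau> = k}"

definition order_isomorphic :: "nat list \<Rightarrow> nat list \<Rightarrow> bool" where
  "order_isomorphic xs ys \<longleftrightarrow>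
     length xs = length ys \<and>
     (\<forall>i < length xs. \<forall>j < length xs. xs ! i < xs ! j \<longleftrightarrow> ys ! i < ys ! j)"

definition avoids :: "nat list \<Rightarrow> nat list \<Rightarrow> bool" where
  "avoids \<sigma> \<pi> \<longleftrightarrow> \<not> (\<exists>xs. subseq xs \<sigma> \<and> order_isomorphic xs \<pi>)"

definition Av :: "nat \<Rightarrow> nat list set \<Rightarrow> nat list set" where
  "Av n P = {\<sigma> \<in> perms n. \<forall>\<pi> \<in> P. avoids \<sigma> \<pi>}"

definition Gamma_perms :: "nat \<Rightarrow> nat list set" where
  "Gamma_perms k = {\<sigma> \<in> perms k. \<sigma> \<noteq> [] \<and> last \<sigma> = 1}"

definition phi :: "nat \<Rightarrow> nat \<Rightarrow> nat" where
  "phi n k = card (Av n (Gamma_perms k))"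

end

theory Submission
  imports Defs
begin

text \<open>
  Count, for each entry of a permutation, the larger entries to its left. One bubblesort pass
  lowers every nonzero count by one, because the carried left-to-right maximum jumps over
  exactly the entries that are not left-to-right maxima. Hence the height of a node is its
  maximal count. An entry with \<open>m\<close> larger entries to its left is the same as an occurrence
  of a pattern from \<open>\<Gamma>\<^sub>m\<^sub>+\<^sub>1\<close>, so \<open>\<phi>\<^sub>n\<close> counts the nodes of bounded height. Removing
  the last entry shows that the permutations with all counts at most \<open>k\<close> number
  \<open>\<Prod>i=1..n. min i (k + 1)\<close>.
\<close>

section \<open>Bounds on the number of larger entries to the left\<close>

text \<open>\<open>M\<close> collects the entries already passed, to the left of the list.\<close>

fun larger_left_le :: "nat \<Rightarrow> 'a::linorder multiset \<Rightarrow> 'a list \<Rightarrow> bool" where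
  "larger_left_le k M [] \<longleftrightarrow> True"
| "larger_left_le k M (x # xs) \<longleftrightarrow>
     size (filter_mset ((<) x) M) \<le> k \<and> larger_left_le k (add_mset x M) xs"

lemma larger_left_le_append:
  "larger_left_le k M (xs @ ys) \<longleftrightarrow> larger_left_le k M xs \<and> larger_left_le k (M + mset xs) ys"
  by (induction xs arbitrary: M) auto

text \<open>The recursion reads from the left, but appending an entry at the right end only tests
  that entry against the whole prefix, so induction from the right applies. The decompositions link
  the bound to pattern occurrences.\<close>

lemma larger_left_le_iff:
  "larger_left_le k {#} xs \<longleftrightarrow>
     (\<forall>as x bs. xs = as @ x # bs \<longrightarrow> length (filter ((<) x) as) \<le> k)"
proof (induction xs rule: rev_induct)
  case (snoc y xs)
  have *: "size (filter_mset ((<) y) (mset xs)) = length (filter ((<) y) xs)"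
    by (metis mset_filter size_mset)
  have split: "xs @ [y] = as @ x # bs \<longleftrightarrow>
      as = xs \<and> x = y \<and> bs = [] \<or> (\<exists>cs. bs = cs @ [y] \<and> xs = as @ x # cs)" for as x bs
    by (cases bs rule: rev_cases) auto
  show ?case
    unfolding larger_left_le_append snoc split using * by auto
qed simp

lemma larger_left_le_mono:
  "larger_left_le k M xs \<Longrightarrow> k \<le> l \<Longrightarrow> larger_left_le l M xs"
  by (induction xs arbitrary: M) auto

lemma larger_left_le_length: "larger_left_le (length xs) {#} xs"
  unfolding larger_left_le_iff by (auto intro: le_trans[OF length_filter_le])

lemma larger_left_le_0: "larger_left_le 0 {#} xs \<longleftrightarrow> sorted xs"
proof (induction xs rule: rev_induct)
  case (snoc x xs)
  then show ?case
    by (auto simp: larger_left_le_append sorted_append not_less)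
qed simp

section \<open>Effect of one bubblesort pass\<close>

text \<open>Here \<open>x\<close> is the element carried by the pass and \<open>M\<close> holds the
  entries already output. A smaller next entry moves in front of \<open>x\<close> and so loses
  exactly one larger entry on its left; hence \<open>Suc k\<close> on the right, where
  \<open>x\<close> still precedes \<open>xs\<close>.\<close>

lemma larger_left_le_pass_Cons:
  assumes "\<forall>y\<in>#M. y \<le> x"
  shows "larger_left_le k M (bubblesort_pass (x # xs)) \<longleftrightarrow>
    larger_left_le (Suc k) (add_mset x M) xs"
  using assms
proof (induction xs arbitrary: x M)
  case Nil
  then have "size (filter_mset ((<) x) M) = 0" by auto
  then show ?case by (simp only: bubblesort_pass.simps larger_left_le.simps) simp
next
  case (Cons z xs)
  show ?case
  proof (cases "z < x")
    case True
    then show ?thesis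
      using Cons.IH[of "add_mset z M" x] Cons.prems by (auto simp: add_mset_commute)
  next
    case False
    \<comment> \<open>Since \<open>M\<close> lies below \<open>x\<close> and
      \<open>x \<le> z\<close>, nothing larger precedes \<open>x\<close> in the output or
      \<open>z\<close> in the input: both tests hold for every bound, and \<open>z\<close> becomes
      the carried element.\<close>
    have "size (filter_mset ((<) x) M) = 0" "size (filter_mset ((<) z) (add_mset x M)) = 0"
      using Cons.prems False by force+
    moreover have "larger_left_le k (add_mset x M) (bubblesort_pass (z # xs)) \<longleftrightarrow>
        larger_left_le (Suc k) (add_mset z (add_mset x M)) xs"
      using Cons.prems False by (intro Cons.IH) auto
    ultimately show ?thesis
      using False by (simp only: bubblesort_pass.simps larger_left_le.simps if_False) simp
  qed
qed

lemma larger_left_le_pass: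
  "larger_left_le k {#} (bubblesort_pass xs) \<longleftrightarrow> larger_left_le (Suc k) {#} xs"
  by (cases xs) (simp_all add: larger_left_le_pass_Cons)

lemma mset_bubblesort_pass: "mset (bubblesort_pass xs) = mset xs"
  by (induction xs rule: bubblesort_pass.induct) auto

lemma bubblesort_pass_sorted: "sorted xs \<Longrightarrow> bubblesort_pass xs = xs"
  by (induction xs rule: bubblesort_pass.induct) auto

lemma perms_iff: "xs \<in> perms n \<longleftrightarrow> set xs = {1..n} \<and> distinct xs"
  by (auto simp: perms_def permutations_of_set_def)

lemma perms_length: "xs \<in> perms n \<Longrightarrow> length xs = n"
  using distinct_card by (fastforce simp: perms_iff)

lemma finite_perms [simp]: "finite (perms n)"
  by (simp add: perms_def)

lemma id_perm_in_perms [simp]: "id_perm n \<in> perms n"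
  by (auto simp: perms_iff id_perm_def)

lemma sorted_id_perm [simp]: "sorted (id_perm n)"
  by (simp add: id_perm_def del: upt_Suc)

lemma sorted_perm_iff:
  assumes "xs \<in> perms n"
  shows "sorted xs \<longleftrightarrow> xs = id_perm n"
proof
  assume "sorted xs"
  then show "xs = id_perm n"
    using assms id_perm_in_perms[of n]
    by (intro sorted_distinct_set_unique) (auto simp: perms_iff)
qed simp

lemma bubblesort_pass_perms: "xs \<in> perms n \<Longrightarrow> bubblesort_pass xs \<in> perms n"
  unfolding perms_iff by (metis mset_bubblesort_pass mset_eq_setD mset_eq_imp_distinct_iff)

section \<open>Walks from the root and heights\<close>

lemma wf_digraph_bubblesort_tree: "wf_digraph (bubblesort_tree n)"
  by unfold_locales (auto simp: bubblesort_tree_def)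

interpretation bubblesort: wf_digraph "bubblesort_tree n" for n
  by (rule wf_digraph_bubblesort_tree)

lemma verts_bubblesort_tree [simp]: "verts (bubblesort_tree n) = perms n"
  by (simp add: bubblesort_tree_def)

text \<open>A node determines its parent, so the last arc of a walk is forced by its endpoint. This
  rule replaces the general one for appended walks, which is then removed from the
  simplifier.\<close>

lemma awalk_snoc_iff:
  "bubblesort.awalk n u (p @ [e]) \<tau> \<longleftrightarrow>
     e = (bubblesort_pass \<tau>, \<tau>) \<and> \<tau> \<in> perms n \<and> bubblesort_pass \<tau> \<noteq> \<tau> \<and>
     bubblesort.awalk n u p (bubblesort_pass \<tau>)"
proof -
  have arc: "e \<in> arcs (bubblesort_tree n) \<longleftrightarrow>
      e = (bubblesort_pass (head (bubblesort_tree n) e), head (bubblesort_tree n) e) \<and>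
      head (bubblesort_tree n) e \<in> perms n \<and>
      bubblesort_pass (head (bubblesort_tree n) e) \<noteq> head (bubblesort_tree n) e"
    by (cases e) (auto simp: bubblesort_tree_def bubblesort_pass_perms)
  have "bubblesort.awalk n u (p @ [e]) \<tau> \<longleftrightarrow>
      e \<in> arcs (bubblesort_tree n) \<and> head (bubblesort_tree n) e = \<tau> \<and>
      bubblesort.awalk n u p (tail (bubblesort_tree n) e)"
    using bubblesort.head_in_verts[of e n]
    by (auto simp: bubblesort.awalk_Cons_iff bubblesort.awalk_Nil_iff)
  also have "\<dots> \<longleftrightarrow> e = (bubblesort_pass \<tau>, \<tau>) \<and> \<tau> \<in> perms n \<and>
      bubblesort_pass \<tau> \<noteq> \<tau> \<and> bubblesort.awalk n u p (bubblesort_pass \<tau>)"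
    unfolding arc by (cases e) (auto simp: bubblesort_tree_def)
  finally show ?thesis .
qed

declare bubblesort.awalk_append_iff [simp del]

text \<open>Walks are compared from their far end: last arcs into the same node coincide, and no arc
  enters the root because a pass fixes it.\<close>

lemma awalk_unique:
  assumes "bubblesort.awalk n (id_perm n) p \<tau>" "bubblesort.awalk n (id_perm n) q \<tau>"
  shows "p = q"
  using assms
proof (induction p arbitrary: q \<tau> rule: rev_induct)
  case Nil
  then have "\<tau> = id_perm n" by (simp add: bubblesort.awalk_Nil_iff)
  then have "bubblesort_pass \<tau> = \<tau>" by (simp add: bubblesort_pass_sorted)
  then show ?case
    using Nil.prems(2) by (cases q rule: rev_cases) (simp_all add: awalk_snoc_iff)
next
  case (snoc e p)
  have "\<tau> \<noteq> id_perm n"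
    using snoc.prems(1) bubblesort_pass_sorted[of "id_perm n"]
    by (auto simp: awalk_snoc_iff)
  then show ?case
    using snoc by (cases q rule: rev_cases) (auto simp: awalk_snoc_iff bubblesort.awalk_Nil_iff)
qed

text \<open>Each pass lowers the bound by one, so \<open>k\<close> passes sort
  \<open>\<tau>\<close>; read backwards, they give a walk from the root.\<close>

lemma awalk_exists:
  assumes "larger_left_le k {#} \<tau>" "\<tau> \<in> perms n"
  shows "\<exists>p. bubblesort.awalk n (id_perm n) p \<tau>"
  using assms
proof (induction k arbitrary: \<tau>)
  case 0
  then have "\<tau> = id_perm n" by (simp add: larger_left_le_0 sorted_perm_iff)
  then show ?case by (auto simp: bubblesort.awalk_Nil_iff intro!: exI[of _ "[]"])
next
  case (Suc k)
  then obtain p where "bubblesort.awalk n (id_perm n) p (bubblesort_pass \<tau>)"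
    using bubblesort_pass_perms larger_left_le_pass by blast
  \<comment> \<open>The bound \<open>k\<close> need not be sharp: a pass that fixes
    \<open>\<tau>\<close> contributes no arc.\<close>
  then have "bubblesort.awalk n (id_perm n)
      (if bubblesort_pass \<tau> = \<tau> then p else p @ [(bubblesort_pass \<tau>, \<tau>)]) \<tau>"
    using Suc.prems awalk_snoc_iff[of n "id_perm n" p "(bubblesort_pass \<tau>, \<tau>)" \<tau>]
    by (cases "bubblesort_pass \<tau> = \<tau>") simp_all
  then show ?case by blast
qed

text \<open>Removing the last arc applies one pass, which lowers both the length and the bound by
  one. As \<open>k\<close> is arbitrary, this determines the length exactly.\<close>

lemma awalk_length_le_iff:
  assumes "bubblesort.awalk n (id_perm n) p \<tau>"
  shows "length p \<le> k \<longleftrightarrow> larger_left_le k {#} \<tau>"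
  using assms
proof (induction p arbitrary: \<tau> k rule: rev_induct)
  case Nil
  then have "sorted \<tau>" by (auto simp: bubblesort.awalk_Nil_iff)
  then show ?case
    using larger_left_le_mono[of 0 "{#}" \<tau> k] by (simp add: larger_left_le_0)
next
  case (snoc e p)
  show ?case
  proof (cases k)
    case 0
    have "\<not> sorted \<tau>"
      using snoc.prems bubblesort_pass_sorted by (auto simp: awalk_snoc_iff)
    then show ?thesis using 0 by (simp add: larger_left_le_0)
  next
    case (Suc l)
    then show ?thesis
      using snoc.IH[of "bubblesort_pass \<tau>" l] snoc.prems
      by (simp add: awalk_snoc_iff larger_left_le_pass)
  qed
qed

lemma height_le_iff:
  assumes "\<tau> \<in> perms n"
  shows "height n \<tau> \<le> k \<longleftrightarrow> larger_left_le k {#} \<tau>"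
proof -
  obtain q where "bubblesort.awalk n (id_perm n) q \<tau>"
    using awalk_exists[OF larger_left_le_length assms] by blast
  \<comment> \<open>Paths are particular walks, so uniqueness of walks makes the \<open>THE\<close>
    in \<open>height\<close> denote this path.\<close>
  then have "bubblesort.apath n (id_perm n) (bubblesort.awalk_to_apath n q) \<tau>"
    by (rule bubblesort.apath_awalk_to_apath)
  then have "bubblesort.apath n (id_perm n) (THE p. bubblesort.apath n (id_perm n) p \<tau>) \<tau>"
    by (rule theI) (metis awalk_unique bubblesort.awalkI_apath
        \<open>bubblesort.apath n (id_perm n) (bubblesort.awalk_to_apath n q) \<tau>\<close>)
  then show ?thesis
    unfolding height_def by (intro awalk_length_le_iff bubblesort.awalkI_apath)
qed

section \<open>Patterns ending in 1\<close>

text \<open>Each entry is replaced by its rank. Ranks increase strictly with the entries, so the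
  order is kept, and by injectivity they fill \<open>{1..length xs}\<close>.\<close>

lemma standardization:
  fixes xs :: "nat list"
  assumes "distinct xs"
  defines "\<pi> \<equiv> map (\<lambda>v. card {w \<in> set xs. w \<le> v}) xs"
  shows "\<pi> \<in> perms (length xs)" "order_isomorphic xs \<pi>"
proof -
  define r where "r v = card {w \<in> set xs. w \<le> v}" for v
  have less: "r u < r v" if "u < v" "v \<in> set xs" for u v
    unfolding r_def using that by (intro psubset_card_mono) force+
  have iff: "r u < r v \<longleftrightarrow> u < v" if "u \<in> set xs" "v \<in> set xs" for u v
    using less that by (metis less_asym' linorder_neqE_nat nat_neq_iff)
  show "order_isomorphic xs \<pi>"
    unfolding order_isomorphic_def \<pi>_def r_def[symmetric] by (auto simp: iff)
  have inj: "inj_on r (set xs)"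
    by (rule inj_onI) (metis iff nat_neq_iff)
  have "r ` set xs \<subseteq> {1..length xs}"
  proof
    fix y assume "y \<in> r ` set xs"
    then obtain v where v: "v \<in> set xs" "y = r v" by blast
    have "{w \<in> set xs. w \<le> v} \<noteq> {}" using v by blast
    then have "0 < r v" by (simp add: r_def card_gt_0_iff)
    moreover have "r v \<le> card (set xs)" unfolding r_def by (intro card_mono) auto
    ultimately show "y \<in> {1..length xs}" using v card_length[of xs] by simp
  qed
  then have "r ` set xs = {1..length xs}"
    using inj assms by (intro card_subset_eq) (auto simp: card_image distinct_card)
  then show "\<pi> \<in> perms (length xs)"
    using inj assms unfolding perms_iff \<pi>_def r_def[symmetric] by (simp add: distinct_map)
qed

text \<open>The last entry of an occurrence is smaller than the \<open>m\<close> entries before it;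
  conversely, \<open>m\<close> larger entries followed by \<open>x\<close> standardize to a pattern
  ending in 1.\<close>

lemma Gamma_perms_occurs_iff:
  assumes "distinct \<sigma>"
  shows "(\<exists>\<pi>\<in>Gamma_perms (Suc m). \<not> avoids \<sigma> \<pi>) \<longleftrightarrow>
    (\<exists>as x bs. \<sigma> = as @ x # bs \<and> m \<le> length (filter ((<) x) as))"
    (is "?L \<longleftrightarrow> ?R")
proof
  assume ?L
  then obtain \<pi> xs where \<pi>: "\<pi> \<in> perms (Suc m)" "\<pi> \<noteq> []" "last \<pi> = 1"
    and xs: "subseq xs \<sigma>" "order_isomorphic xs \<pi>"
    by (auto simp: Gamma_perms_def avoids_def)
  have len: "length xs = Suc m" "length \<pi> = Suc m"
    using perms_length[OF \<pi>(1)] xs(2) by (auto simp: order_isomorphic_def)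
  then obtain ys x where ys: "xs = ys @ [x]" by (cases xs rule: rev_cases) auto
  have last: "\<pi> ! m = 1" using \<pi> len by (simp add: last_conv_nth)
  have greater: "x < y" if y: "y \<in> set ys" for y
  proof -
    obtain i where i: "i < m" "ys ! i = y"
      using y len ys by (auto simp: in_set_conv_nth)
    have "\<pi> ! i \<noteq> \<pi> ! m" "\<pi> ! i \<in> {1..Suc m}"
      using i \<pi> len nth_mem[of i \<pi>] by (auto simp: perms_iff nth_eq_iff_index_eq)
    then have "\<pi> ! m < \<pi> ! i" using last by auto
    then have "xs ! m < xs ! i"
      using xs(2) len i unfolding order_isomorphic_def by simp
    then show ?thesis using i len ys by (auto simp: nth_append)
  qed
  obtain as bs where \<sigma>: "\<sigma> = as @ bs" "subseq ys as" "subseq [x] bs"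
    using xs(1) ys list_emb_appendD by blast
  obtain cs ds where bs: "bs = cs @ x # ds"
    using \<sigma>(3) by (auto simp: subseq_singleton_left dest: split_list)
  \<comment> \<open>Filtering keeps all of \<open>ys\<close>, so its \<open>m\<close> entries embed
    into the larger entries of \<open>as\<close>.\<close>
  have "subseq (filter ((<) x) ys) (filter ((<) x) as)"
    using \<sigma>(2) by (rule subseq_filter)
  moreover have "filter ((<) x) ys = ys" using greater by simp
  ultimately have "length ys \<le> length (filter ((<) x) as)"
    using list_emb_length by fastforce
  then have "\<sigma> = (as @ cs) @ x # ds \<and> m \<le> length (filter ((<) x) (as @ cs))"
    using \<sigma> bs len ys by simp
  then show ?R by blast
next
  assume ?R
  then obtain as x bs where \<sigma>: "\<sigma> = as @ x # bs" and m: "m \<le> length (filter ((<) x) as)"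
    by blast
  \<comment> \<open>Exactly \<open>m\<close> larger entries are kept, so that the pattern has size
    \<open>Suc m\<close>.\<close>
  define ys where "ys = take m (filter ((<) x) as)"
  define xs where "xs = ys @ [x]"
  define \<pi> where "\<pi> = map (\<lambda>v. card {w \<in> set xs. w \<le> v}) xs"
  have len: "length xs = Suc m" using m by (simp add: xs_def ys_def)
  have greater: "x < y" if "y \<in> set ys" for y
    using that by (auto simp: ys_def dest: in_set_takeD)
  have "subseq ys (filter ((<) x) as)"
    unfolding ys_def by (metis append_take_drop_id list_emb_prefix prefix_imp_subseq take_is_prefix)
  then have "subseq ys as"
    using subseq_filter_left subseq_order.trans by blast
  moreover have "subseq [x] (x # bs)" by simp
  ultimately have sub: "subseq xs \<sigma>"
    unfolding xs_def \<sigma> by (intro list_emb_append_mono)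
  have "distinct ys"
    using assms by (simp add: ys_def \<sigma>)
  moreover have "x \<notin> set ys"
    using greater by blast
  ultimately have "distinct xs"
    by (simp add: xs_def)
  note std = standardization[OF this, folded \<pi>_def]
  \<comment> \<open>As the minimum of \<open>xs\<close>, \<open>x\<close> has rank 1.\<close>
  have "{w \<in> set xs. w \<le> x} = {x}"
    by (auto simp: xs_def dest: greater)
  then have "last \<pi> = 1" by (simp add: \<pi>_def last_map xs_def)
  then have "\<pi> \<in> Gamma_perms (Suc m)"
    using std(1) len by (auto simp: Gamma_perms_def \<pi>_def)
  then show ?L using std(2) sub by (auto simp: avoids_def)
qed

lemma phi_Suc:
  assumes "n \<ge> 1"
  shows "phi n (Suc m) = card {\<tau> \<in> perms n. height n \<tau> < m}"
proof -
  have "(\<forall>\<pi>\<in>Gamma_perms (Suc m). avoids \<tau> \<pi>) \<longleftrightarrow> height n \<tau> < m" if \<tau>: "\<tau> \<in> perms n" for \<tau>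
  proof -
    have "(\<forall>\<pi>\<in>Gamma_perms (Suc m). avoids \<tau> \<pi>) \<longleftrightarrow>
        (\<forall>as x bs. \<tau> = as @ x # bs \<longrightarrow> length (filter ((<) x) as) < m)"
    proof -
      have "distinct \<tau>" using \<tau> by (simp add: perms_iff)
      from Gamma_perms_occurs_iff[OF this, of m] show ?thesis by (metis not_le)
    qed
    also have "\<dots> \<longleftrightarrow> height n \<tau> < m"
    proof (cases m)
      \<comment> \<open>The pattern is the single entry 1, which occurs in every nonempty
        permutation, so both sides are false.\<close>
      case 0
      have "\<tau> \<noteq> []" using perms_length[OF \<tau>] assms by auto
      then have "\<exists>as x bs. \<tau> = as @ x # bs" by (metis append_Nil list.exhaust)
      then show ?thesis using 0 by auto
    next
      case (Suc l)
      then show ?thesis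
        using height_le_iff[OF \<tau>, of l] by (simp add: larger_left_le_iff less_Suc_eq_le)
    qed
    finally show ?thesis .
  qed
  then have "Av n (Gamma_perms (Suc m)) = {\<tau> \<in> perms n. height n \<tau> < m}"
    by (auto simp: Av_def)
  then show ?thesis by (simp add: phi_def)
qed

section \<open>Counting permutations with bounded counts\<close>

text \<open>Counting the larger elements maps \<open>A\<close> bijectively onto
  \<open>{..<card A}\<close>, so exactly the top \<open>Suc k\<close> elements qualify, or all of
  \<open>A\<close> if it is smaller.\<close>

lemma card_few_larger:
  fixes A :: "'a::linorder set"
  assumes "finite A"
  shows "card {x \<in> A. card {y \<in> A. x < y} \<le> k} = min (card A) (Suc k)"
proof -
  define f where "f x = card {y \<in> A. x < y}" for x
  have less: "f v < f u" if "u < v" "v \<in> A" for u v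
    unfolding f_def using that assms by (intro psubset_card_mono) force+
  have inj: "inj_on f A"
    by (rule inj_onI) (metis less less_irrefl linorder_neqE)
  have "f ` A \<subseteq> {..<card A}"
    unfolding f_def using assms by (auto intro!: psubset_card_mono)
  then have img: "f ` A = {..<card A}"
    using inj by (intro card_subset_eq) (auto simp: card_image)
  have "card {x \<in> A. f x \<le> k} = card (f ` {x \<in> A. f x \<le> k})"
    using inj by (intro card_image[symmetric]) (auto intro: inj_on_subset)
  also have "f ` {x \<in> A. f x \<le> k} = f ` A \<inter> {..k}" by auto
  also have "\<dots> = {..<min (card A) (Suc k)}" unfolding img by auto
  finally show ?thesis by (simp add: f_def)
qed

text \<open>All other elements stand to the left of the last entry, so its admissible values are
  those of \<open>card_few_larger\<close>, and the remaining entries are constrained independently.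
  Arbitrary finite sets appear because deleting the last entry leaves the form
  \<open>{1..n}\<close>.\<close>

lemma card_larger_left_le:
  fixes A :: "'a::linorder set"
  assumes "finite A"
  shows "card {xs \<in> permutations_of_set A. larger_left_le k {#} xs} =
    (\<Prod>i=1..card A. min i (Suc k))"
  using assms
proof (induction "card A" arbitrary: A)
  case 0
  then have "{xs \<in> permutations_of_set A. larger_left_le k {#} xs} = {[]}" by auto
  then show ?case using 0 by simp
next
  case (Suc m)
  let ?P = "\<lambda>A. {xs \<in> permutations_of_set A. larger_left_le k {#} xs}"
  let ?X = "{x \<in> A. card {y \<in> A. x < y} \<le> k}"
  have count: "size (filter_mset ((<) x) (mset xs)) = card {y \<in> A. x < y}"
    if "set xs = A - {x}" "distinct xs" for x and xs :: "'a list"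
  proof -
    have "size (filter_mset ((<) x) (mset xs)) = length (filter ((<) x) xs)"
      by (metis mset_filter size_mset)
    also have "\<dots> = card (set (filter ((<) x) xs))"
      using that by (simp only: distinct_card distinct_filter)
    also have "set (filter ((<) x) xs) = {y \<in> A. x < y}" using that by auto
    finally show ?thesis .
  qed
  have "?P A = (\<Union>x\<in>?X. (\<lambda>xs. xs @ [x]) ` ?P (A - {x}))"
  proof (intro set_eqI iffI)
    fix ys assume ys: "ys \<in> ?P A"
    then have "ys \<noteq> []" using Suc by (auto simp: permutations_of_set_def)
    then obtain xs x where "ys = xs @ [x]" by (metis rev_exhaust)
    with ys count[of xs x] show "ys \<in> (\<Union>x\<in>?X. (\<lambda>xs. xs @ [x]) ` ?P (A - {x}))"
      by (auto simp: permutations_of_set_def larger_left_le_append)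
  next
    fix ys assume "ys \<in> (\<Union>x\<in>?X. (\<lambda>xs. xs @ [x]) ` ?P (A - {x}))"
    then show "ys \<in> ?P A"
      using count by (auto simp: permutations_of_set_def larger_left_le_append)
  qed
  then have "card (?P A) = (\<Sum>x\<in>?X. card ((\<lambda>xs. xs @ [x]) ` ?P (A - {x})))"
    using Suc by (simp only:) (rule card_UN_disjoint; auto)
  also have "\<dots> = (\<Sum>x\<in>?X. \<Prod>i=1..m. min i (Suc k))"
  proof (intro sum.cong refl)
    fix x assume "x \<in> ?X"
    then have x: "m = card (A - {x})" using Suc by simp
    have "card ((\<lambda>xs. xs @ [x]) ` ?P (A - {x})) = card (?P (A - {x}))"
      by (intro card_image) (auto intro: inj_onI)
    then show "card ((\<lambda>xs. xs @ [x]) ` ?P (A - {x})) = (\<Prod>i=1..m. min i (Suc k))"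
      using Suc.hyps(1)[OF x] Suc.prems x by simp
  qed
  also have "\<dots> = min (Suc m) (Suc k) * (\<Prod>i=1..m. min i (Suc k))"
    using card_few_larger[OF Suc.prems, of k] Suc.hyps(2) by simp
  also have "\<dots> = (\<Prod>i=1..card A. min i (Suc k))"
    using Suc.hyps(2)[symmetric] by simp
  finally show ?case .
qed

text \<open>The factors up to \<open>k\<close> form the factorial; each of the other
  \<open>n - k\<close> equals \<open>Suc k\<close>.\<close>

lemma prod_min_eq:
  assumes "k \<le> n"
  shows "(\<Prod>i=1..n. min i (Suc k)) = Suc k ^ (n - k) * fact k"
  using assms
proof (induction n rule: dec_induct)
  case base
  have "(\<Prod>i=1..k. min i (Suc k)) = \<Prod>{1..k}"
    by (intro prod.cong) auto
  then show ?case by (simp add: fact_prod)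
next
  case (step n)
  then show ?case by (simp add: Suc_diff_le algebra_simps)
qed

section \<open>Closed forms\<close>

lemma phi_Suc_Suc:
  assumes "n \<ge> 1" "k \<le> n"
  shows "phi n (Suc (Suc k)) = Suc k ^ (n - k) * fact k"
proof -
  have "{\<tau> \<in> perms n. height n \<tau> < Suc k} =
      {\<tau> \<in> permutations_of_set {1..n}. larger_left_le k {#} \<tau>}"
    using height_le_iff by (auto simp: perms_def less_Suc_eq_le)
  then show ?thesis
    using card_larger_left_le[of "{1..n}" k] assms(1) prod_min_eq[OF assms(2)]
    by (simp add: phi_Suc)
qed

theorem corollary4p2:
  fixes n k :: nat
  assumes "n \<ge> 1" and "k \<le> n - 1"
  shows "int (num_at_height n k) = int (phi n (k + 2)) - int (phi n (k + 1))
    \<and> int (phi n (k + 2)) - int (phi n (k + 1))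
        = (int k + 1) ^ (n - k - 1) * fact (k + 1) - int k ^ (n - k) * fact k
    \<and> (int k + 1) ^ (n - k - 1) * fact (k + 1) - int k ^ (n - k) * fact k
        = fact k * ((int k + 1) ^ (n - k) - int k ^ (n - k))"
proof -
  have lt: "k < n" using assms by simp
  have "{\<tau> \<in> perms n. height n \<tau> < Suc k} =
      {\<tau> \<in> perms n. height n \<tau> = k} \<union> {\<tau> \<in> perms n. height n \<tau> < k}"
    by auto
  then have split: "phi n (Suc (Suc k)) = num_at_height n k + phi n (Suc k)"
    using assms(1) by (simp add: phi_Suc num_at_height_def card_Un_disjoint disjoint_iff)
  \<comment> \<open>\<open>phi_Suc_Suc\<close> starts at pattern size 2. For \<open>k = 0\<close> no
    node has negative height, and the power of 0 vanishes as \<open>n \<ge> 1\<close>.\<close>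
  have lower: "phi n (Suc k) = k ^ (n - k) * fact k"
  proof (cases k)
    case 0
    then show ?thesis using assms by (simp add: phi_Suc)
  next
    case (Suc l)
    \<comment> \<open>The extra factor \<open>k\<close> in the power turns \<open>fact l\<close>
      into \<open>fact k\<close>.\<close>
    have "n - l = Suc (n - k)" using Suc lt by simp
    then show ?thesis
      using phi_Suc_Suc[of n l] Suc lt by (simp add: algebra_simps)
  qed
  have upper: "phi n (Suc (Suc k)) = Suc k ^ (n - k) * fact k"
    using phi_Suc_Suc lt by simp
  have absorb: "(int k + 1) ^ (n - k - 1) * fact (k + 1) = (int k + 1) ^ (n - k) * fact k"
  proof -
    have "n - k = Suc (n - k - 1)" using lt by simp
    then have "(int k + 1) ^ (n - k) = (int k + 1) ^ (n - k - 1) * (int k + 1)"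
      by (metis power_Suc2)
    then show ?thesis by (simp add: algebra_simps)
  qed
  have "int (phi n (k + 1)) = int k ^ (n - k) * fact k"
    using lower by simp
  moreover have "int (phi n (k + 2)) = (int k + 1) ^ (n - k) * fact k"
    using upper by (simp add: add.commute)
  moreover have "int (num_at_height n k) = int (phi n (k + 2)) - int (phi n (k + 1))"
    using split by simp
  ultimately show ?thesis
    unfolding absorb by (simp add: right_diff_distrib mult.commute)
qed

end
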